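(* Let $d=4$. Every non-degenerate system of Monge–Ampère type is ${\bf SL}(6)$-equivalent to one of the following normal forms: 1. $u_2-v_1=0,\ \ u_3+v_4=0$; 2. $u_2-v_1=0,\ \ u_3+v_4+u_1v_2-u_2v_1=0$; 3. $u_2-v_1=0,\ \ u_3v_4-u_4v_3-1=0$; 4. $u_2-v_1=0,\ \ u_1+v_2+u_3v_4-u_4v_3=0$.
   Context: All objects are complex (locally analytic). Let $u(\mathbf x),v(\mathbf x)$ be functions of $\mathbf x=(x^1,\dots,x^d)$, with $u_i=\partial u/\partial x^i$, $v_i=\partial v/\partial x^i$. Let $V=\mathbb{C}^{d+2}$ with coordinates $(x^1,\dots,x^d,u,v)$. A system of Monge–Ampère type is a pair of linearly independent equations $$a^{ij}(u_iv_j-u_jv_i)+b^iu_i+c^iv_i+m=0,\qquad \alpha^{ij}(u_iv_j-u_jv_i)+\beta^iu_i+\gamma^iv_i+\mu=0$$ with constant coefficients. Geometrically the tangent $d$-planes of graphs $u=u(\mathbf x),v=v(\mathbf x)$ are points of ${\bf Gr}(d,V)$ and the system defines a codimension-two submanifold $X\subset{\bf Gr}(d,V)$ (a linear section of its Plücker embedding); solutions are $d$-dimensional submanifolds of $V$ whose tangent spaces lie in $X$. Two systems are ${\bf SL}(d+2)$-equivalent if an element of ${\bf SL}(V)$ (linear change of the coordinates $(x,u,v)$), acting on ${\bf Gr}(d,V)$, maps the $X$ of one to the $X$ of the other. A system $F=G=0$ is non-degenerate if its characteristic variety $\det\big[\sum_{i=1}^d p_i\begin{pmatrix}F_{u_i}&F_{v_i}\\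 G_{u_i}&G_{v_i}\end{pmatrix}\big]=0$ is an irreducible quadric in $p_1,\dots,p_d$ of rank $d$ when $d\le4$ and of rank $4$ when $d>4$. *)

theory Defs
  imports "HOL-Analysis.Analysis"
begin

text \<open>Monge-Ampere type systems in dimension d = 4.
  The coordinates of V = C^6 are indexed by the type 4 + 2:
  Inl i is x^(i+1) (i = 0..3), Inr 0 is u and Inr 1 is v.
  Paper index k (1..4) corresponds to index k-1 of type 4.\<close>

type_synonym mat64 = "complex^4^(4 + 2)"
type_synonym mat66 = "complex^(4 + 2)^(4 + 2)"

type_synonym eqn = "(complex^4^4) \<times> (complex^4) \<times> (complex^4) \<times> complex"

definition eq_val :: "eqn \<Rightarrow> complex^4 \<Rightarrow> complex^4 \<Rightarrow> complex" where
  "eq_val E u v = (case E of (a, b, c, m) \<Rightarrow>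
     (\<Sum>i\<in>UNIV. \<Sum>j\<in>UNIV. a$i$j * (u$i * v$j - u$j * v$i))
     + (\<Sum>i\<in>UNIV. b$i * u$i) + (\<Sum>i\<in>UNIV. c$i * v$i) + m)"

definition eq_du :: "eqn \<Rightarrow> complex^4 \<Rightarrow> complex^4 \<Rightarrow> 4 \<Rightarrow> complex" where
  "eq_du E u v i = deriv (\<lambda>t. eq_val E (u + t *s axis i 1) v) 0"

definition eq_dv :: "eqn \<Rightarrow> complex^4 \<Rightarrow> complex^4 \<Rightarrow> 4 \<Rightarrow> complex" where
  "eq_dv E u v i = deriv (\<lambda>t. eq_val E u (v + t *s axis i 1)) 0"

definition lin_indep_eqns :: "eqn \<Rightarrow> eqn \<Rightarrow> bool" where
  "lin_indep_eqns F G \<longleftrightarrow>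
     (\<forall>s t. (\<forall>u v. s * eq_val F u v + t * eq_val G u v = 0) \<longrightarrow> s = 0 \<and> t = 0)"

definition char_form :: "eqn \<Rightarrow> eqn \<Rightarrow> complex^4 \<Rightarrow> complex^4 \<Rightarrow> complex^4 \<Rightarrow> complex" where
  "char_form F G u v p = det (\<chi> r s :: 2. \<Sum>i\<in>UNIV. p$i *
      (if r = 0 then (if s = 0 then eq_du F u v i else eq_dv F u v i)
                else (if s = 0 then eq_du G u v i else eq_dv G u v i)))"

definition lin_form :: "complex^4 \<Rightarrow> complex^4 \<Rightarrow> complex" where
  "lin_form l p = (\<Sum>i\<in>UNIV. l$i * p$i)"

text \<open>A quadratic form (in 4 variables) defines an irreducible quadric iff it is not a
  product of two linear forms (this also excludes the zero form).\<close>
definition irreducible_quadric :: "(complex^4 \<Rightarrow> complex) \<Rightarrow> bool" where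
  "irreducible_quadric q \<longleftrightarrow> \<not> (\<exists>l1 l2. \<forall>p. q p = lin_form l1 p * lin_form l2 p)"

definition quadric_rank4 :: "(complex^4 \<Rightarrow> complex) \<Rightarrow> bool" where
  "quadric_rank4 q \<longleftrightarrow> (\<exists>S :: complex^4^4. transpose S = S \<and>
      (\<forall>p. q p = (\<Sum>i\<in>UNIV. p$i * (S *v p)$i)) \<and> det S \<noteq> 0)"

definition sol_pts :: "eqn \<Rightarrow> eqn \<Rightarrow> ((complex^4) \<times> (complex^4)) set" where
  "sol_pts F G = {(u, v). eq_val F u v = 0 \<and> eq_val G u v = 0}"

text \<open>Non-degenerate: the characteristic variety is an irreducible quadric of rank d = 4
  at generic points of X, i.e. on a dense subset of the (nonempty) set of points of X.\<close>
definition nondegenerate :: "eqn \<Rightarrow> eqn \<Rightarrow> bool" where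
  "nondegenerate F G \<longleftrightarrow> lin_indep_eqns F G \<and> sol_pts F G \<noteq> {} \<and>
     sol_pts F G \<subseteq> closure {(u, v) \<in> sol_pts F G.
        irreducible_quadric (char_form F G u v) \<and> quadric_rank4 (char_form F G u v)}"

text \<open>Points of Gr(4, V): represented by 6x4 matrices M of rank 4 (columns a basis of the
  4-plane); the Plucker-linear conditions below are invariant under M \<mapsto> M B, B in GL(4).\<close>
definition full_rank :: "mat64 \<Rightarrow> bool" where
  "full_rank M \<longleftrightarrow> (\<forall>x. M *v x = 0 \<longrightarrow> x = 0)"

definition rowsel :: "mat64 \<Rightarrow> (4 \<Rightarrow> 4 + 2) \<Rightarrow> complex^4^4" where
  "rowsel M r = (\<chi> i j. M $ (r i) $ j)"

text \<open>Plucker coordinates in the graph chart: det A (A = x-block), the generalized Cramer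
  minors corresponding to u_k, v_k and u_i v_j - u_j v_i.\<close>
definition pl_1 :: "mat64 \<Rightarrow> complex" where
  "pl_1 M = det (rowsel M Inl)"

definition pl_u :: "mat64 \<Rightarrow> 4 \<Rightarrow> complex" where
  "pl_u M k = det (rowsel M (\<lambda>i. if i = k then Inr 0 else Inl i))"

definition pl_v :: "mat64 \<Rightarrow> 4 \<Rightarrow> complex" where
  "pl_v M k = det (rowsel M (\<lambda>i. if i = k then Inr 1 else Inl i))"

definition pl_uv :: "mat64 \<Rightarrow> 4 \<Rightarrow> 4 \<Rightarrow> complex" where
  "pl_uv M i j = (if i = j then 0 else
     det (rowsel M (\<lambda>l. if l = i then Inr 0 else if l = j then Inr 1 else Inl l)))"

definition hom_val :: "eqn \<Rightarrow> mat64 \<Rightarrow> complex" where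
  "hom_val E M = (case E of (a, b, c, m) \<Rightarrow>
     (\<Sum>i\<in>UNIV. \<Sum>j\<in>UNIV. a$i$j * pl_uv M i j)
     + (\<Sum>i\<in>UNIV. b$i * pl_u M i) + (\<Sum>i\<in>UNIV. c$i * pl_v M i) + m * pl_1 M)"

definition sysX :: "eqn \<Rightarrow> eqn \<Rightarrow> mat64 set" where
  "sysX F G = {M. full_rank M \<and> hom_val F M = 0 \<and> hom_val G M = 0}"

definition sl_equiv :: "eqn \<times> eqn \<Rightarrow> eqn \<times> eqn \<Rightarrow> bool" where
  "sl_equiv S S' \<longleftrightarrow> (\<exists>g :: mat66. det g = 1 \<and>
     (\<forall>M. full_rank M \<longrightarrow>
        (M \<in> sysX (fst S) (snd S) \<longleftrightarrow> g ** M \<in> sysX (fst S') (snd S'))))"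

definition amat :: "4 \<Rightarrow> 4 \<Rightarrow> complex^4^4" where
  "amat i j = (\<chi> k l. if k = i \<and> l = j then 1 else 0)"

text \<open>Normal forms (paper index k is index k-1 here).\<close>
definition eq_u2_minus_v1 :: eqn where
  "eq_u2_minus_v1 = (0, axis 1 1, axis 0 (-1), 0)"

definition NF1 :: "eqn \<times> eqn" where
  "NF1 = (eq_u2_minus_v1, (0, axis 2 1, axis 3 1, 0))"

definition NF2 :: "eqn \<times> eqn" where
  "NF2 = (eq_u2_minus_v1, (amat 0 1, axis 2 1, axis 3 1, 0))"

definition NF3 :: "eqn \<times> eqn" where
  "NF3 = (eq_u2_minus_v1, (amat 2 3, 0, 0, -1))"

definition NF4 :: "eqn \<times> eqn" where
  "NF4 = (eq_u2_minus_v1, (amat 2 3, axis 0 1, axis 1 1, 0))"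

end

theory Submission
  imports Defs "HOL-Computational_Algebra.Fundamental_Theorem_Algebra"
begin

text \<open>An equation of Monge-Ampere type is a bivector on \<open>V\<close>, so a system is a pencil of bivectors.
  At a single solution point whose characteristic quadric has rank 4, the four linear forms given by
  the \<open>u\<close>- and \<open>v\<close>-derivatives of the two equations are independent. They give a basis
  \<open>a, b, w1, ..., w4\<close> of \<open>V\<close> in which the pencil is \<open>a \<and> w1 + b \<and> w2 + A\<close>, \<open>a \<and> w3 + b \<and> w4 + B\<close>
  with \<open>A\<close>, \<open>B\<close> bivectors in the \<open>w\<close>'s. Shifting \<open>a\<close> and \<open>b\<close> by combinations of the \<open>w\<close>'s
  removes all of \<open>A\<close> and \<open>B\<close> except the terms \<open>w1 \<and> w2\<close> and \<open>w3 \<and> w4\<close>; the four remaining numbers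
  are the coefficients of a binary cubic, on which a change of basis of the pencil acts by linear
  substitution. The four normal forms are the four orbits of binary cubics: zero, a triple root,
  a double root, and three distinct roots.\<close>

section \<open>Determinants with an identity block\<close>

lemma map_sum_permutes:
  fixes p :: "'m::finite \<Rightarrow> 'm"
  assumes "p permutes UNIV"
  shows "(map_sum p id :: 'm + 'n \<Rightarrow> 'm + 'n) permutes UNIV"
proof -
  have b: "bij p" using assms by (simp add: permutes_bij)
  have "bij (map_sum p id :: 'm + 'n \<Rightarrow> 'm + 'n)"
  proof (rule o_bij)
    show "map_sum (inv p) id \<circ> map_sum p id = (id :: 'm + 'n \<Rightarrow> _)"
      using b by (simp add: map_sum.comp bij_is_inj map_sum.id)
    show "map_sum p id \<circ> map_sum (inv p) id = (id :: 'm + 'n \<Rightarrow> _)"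
      using b by (simp add: map_sum.comp bij_is_surj surj_iff[THEN iffD1] map_sum.id)
  qed
  then show ?thesis by (rule bij_imp_permutes) simp
qed

text \<open>By induction over transpositions: \<open>map_sum\<close> sends the transposition of
  \<open>a\<close>, \<open>b\<close> to that of \<open>Inl a\<close>, \<open>Inl b\<close>, so each
  factor contributes the same sign.\<close>

lemma sign_map_sum:
  fixes p :: "'m::finite \<Rightarrow> 'm"
  assumes "p permutes UNIV"
  shows "sign (map_sum p id :: 'm + 'n::finite \<Rightarrow> 'm + 'n) = sign p"
  using assms finite
proof (induction p rule: permutes_induct)
  case id
  show ?case by (simp only: map_sum.id sign_id)
next
  case (swap a b p)
  have "map_sum (Transposition.transpose a b \<circ> p) id
      = Transposition.transpose (Inl a) (Inl b) \<circ> (map_sum p id :: 'm + 'n \<Rightarrow> 'm + 'n)"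
  proof
    fix x :: "'m + 'n"
    show "map_sum (Transposition.transpose a b \<circ> p) id x
      = (Transposition.transpose (Inl a) (Inl b) \<circ> map_sum p id) x"
      by (cases x) (auto simp: Transposition.transpose_def)
  qed
  moreover have "permutation p" "permutation (map_sum p id :: 'm + 'n \<Rightarrow> 'm + 'n)"
    using swap map_sum_permutes[of p] by (auto simp: permutation_permutes)
  ultimately show ?case
    using swap by (simp only: sign_compose permutation_swap_id sign_swap_id) simp
qed

text \<open>In the Leibniz formula a permutation that moves some \<open>Inr k\<close> meets a zero
  entry of row \<open>Inr k\<close>. The survivors fix every \<open>Inr k\<close>, hence are exactly
  the \<open>map_sum q id\<close>.\<close>

lemma det_block_identity:
  fixes B :: "'a::comm_ring_1^('m::finite + 'n::finite)^('m + 'n)"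
  assumes B: "\<And>k J. B $ Inr k $ J = (if J = Inr k then 1 else 0)"
  shows "det B = det (\<chi> i j. B $ Inl i $ Inl j)"
proof -
  let ?T = "\<lambda>p. of_int (sign p) * (\<Prod>I\<in>UNIV. B $ I $ p I)"
  let ?S = "(\<lambda>q. map_sum q id :: 'm + 'n \<Rightarrow> 'm + 'n) ` {q. q permutes UNIV}"
  have S: "p \<in> ?S" if p: "p permutes UNIV" and fx: "\<And>k. p (Inr k) = Inr k" for p :: "'m + 'n \<Rightarrow> 'm + 'n"
  proof -
    have inj: "inj p" using p by (simp add: permutes_inj)
    have "\<exists>j. p (Inl i) = Inl j" for i
    proof (cases "p (Inl i)")
      case (Inr k)
      then have "p (Inl i) = p (Inr k)" using fx by simp
      then show ?thesis using inj by (auto dest: injD)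
    qed auto
    then obtain q where q: "\<And>i. p (Inl i) = Inl (q i)" by metis
    have "inj q" by (rule injI) (metis q inj injD sum.inject(1))
    then have "bij q" by (simp add: bij_def finite_UNIV_inj_surj)
    then have "q permutes UNIV" by (rule bij_imp_permutes) simp
    moreover have "p = map_sum q id"
    proof
      fix x show "p x = map_sum q id x" by (cases x) (auto simp: q fx)
    qed
    ultimately show ?thesis by blast
  qed
  have "det B = sum ?T {p. p permutes UNIV}" by (simp add: det_def)
  also have "\<dots> = sum ?T ?S"
  proof (rule sum.mono_neutral_right)
    show "finite {p :: 'm + 'n \<Rightarrow> 'm + 'n. p permutes UNIV}" by (simp add: finite_permutations)
    show "?S \<subseteq> {p. p permutes UNIV}" by (auto intro: map_sum_permutes)
    show "\<forall>p\<in>{p. p permutes UNIV} - ?S. ?T p = 0"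
    proof
      fix p :: "'m + 'n \<Rightarrow> 'm + 'n" assume "p \<in> {p. p permutes UNIV} - ?S"
      then obtain k where "p (Inr k) \<noteq> Inr k" using S by blast
      then have "B $ Inr k $ p (Inr k) = 0" using B by simp
      then have "(\<Prod>I\<in>UNIV. B $ I $ p I) = 0" by (metis UNIV_I finite prod_zero)
      then show "?T p = 0" by simp
    qed
  qed
  also have "\<dots> = (\<Sum>q | q permutes UNIV. ?T (map_sum q id))"
  proof (rule sum.reindex_cong[where l = "\<lambda>q. map_sum q id", OF _ refl refl])
    show "inj_on (\<lambda>q :: 'm \<Rightarrow> 'm. map_sum q id :: 'm + 'n \<Rightarrow> 'm + 'n) {q. q permutes UNIV}"
      by (rule inj_onI) (metis ext map_sum.simps(1) sum.inject(1))
  qed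
  also have "\<dots> = (\<Sum>q | q permutes UNIV. of_int (sign q) * (\<Prod>i\<in>UNIV. B $ Inl i $ Inl (q i)))"
  proof (rule sum.cong[OF refl])
    fix q :: "'m \<Rightarrow> 'm" assume "q \<in> {q. q permutes UNIV}"
    then have "sign (map_sum q id :: 'm + 'n \<Rightarrow> 'm + 'n) = sign q" by (simp add: sign_map_sum)
    moreover have "(\<Prod>I\<in>UNIV. B $ I $ map_sum q id I) = (\<Prod>i\<in>UNIV. B $ Inl i $ Inl (q i))"
      unfolding UNIV_Plus_UNIV[symmetric] by (subst prod.Plus) (auto simp: B)
    ultimately show "?T (map_sum q id) = of_int (sign q) * (\<Prod>i\<in>UNIV. B $ Inl i $ Inl (q i))"
      by simp
  qed
  finally show ?thesis by (simp add: det_def)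
qed

section \<open>Bivectors as functionals on 4-planes\<close>

text \<open>The bivector \<open>y \<and> z\<close> acting on the Pluecker coordinates of the column space of \<open>M\<close>, that is the
  determinant of \<open>[M | y | z]\<close>, stored transposed so that the row lemmas about determinants apply.\<close>

definition wedge :: "mat64 \<Rightarrow> complex^(4 + 2) \<Rightarrow> complex^(4 + 2) \<Rightarrow> complex" where
  "wedge M y z = det (\<chi> J. if J = Inr 0 then y else if J = Inr 1 then z else column (projl J) M)"

lemma wedge_add_left: "wedge M (x + y) z = wedge M x z + wedge M y z"
  unfolding wedge_def by (rule det_row_add)

lemma wedge_scale_left: "wedge M (c *s y) z = c * wedge M y z"
  unfolding wedge_def by (rule det_row_mul)

lemma wedge_self [simp]: "wedge M y y = 0"
  unfolding wedge_def
  by (rule det_identical_rows[of "Inr 0" "Inr 1"]) (auto simp: row_def)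

text \<open>With the test for \<open>Inr 1\<close> outermost, the row lemmas for determinants match
  the second argument as well.\<close>

lemma wedge_swap_if:
  "wedge M y z = det (\<chi> J. if J = Inr 1 then z else if J = Inr 0 then y else column (projl J) M)"
  unfolding wedge_def by (rule arg_cong[of _ _ det]) (auto simp: vec_eq_iff)

lemma wedge_add_right: "wedge M z (x + y) = wedge M z x + wedge M z y"
  unfolding wedge_swap_if by (rule det_row_add)

lemma wedge_scale_right: "wedge M z (c *s y) = c * wedge M z y"
  unfolding wedge_swap_if by (rule det_row_mul)

lemma wedge_skew: "wedge M z y = - wedge M y z"
proof -
  have "wedge M (y + z) (y + z) = 0" by simp
  then show ?thesis
    unfolding wedge_add_left wedge_add_right by (simp add: add_eq_0_iff)
qed

lemma wedge_minus: "wedge M (- y) z = - wedge M y z" "wedge M z (- y) = - wedge M z y"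
  using wedge_scale_left[of M "-1" y z] wedge_scale_right[of M z "-1" y]
  by (simp_all add: vector_sneg_minus1[symmetric])

lemma wedge_diff:
  "wedge M (x - y) z = wedge M x z - wedge M y z" "wedge M z (x - y) = wedge M z x - wedge M z y"
  using wedge_add_left[of M x "- y" z] wedge_add_right[of M z x "- y"]
  by (simp_all add: wedge_minus)

lemmas wedge_bilinear = wedge_add_left wedge_add_right wedge_scale_left wedge_scale_right
  wedge_minus wedge_diff

lemma wedge_mult: "wedge (g ** M) (g *v y) (g *v z) = det g * wedge M y z"
proof -
  have "(\<chi> J :: 4 + 2. if J = Inr 0 then g *v y else if J = Inr 1 then g *v z else column (projl J) (g ** M))
      = (\<chi> J :: 4 + 2. if J = Inr 0 then y else if J = Inr 1 then z else column (projl J) M) ** transpose g"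
    by (auto simp: vec_eq_iff matrix_matrix_mult_def matrix_vector_mult_def column_def transpose_def mult.commute)
  then show ?thesis unfolding wedge_def by (simp add: det_mul)
qed

text \<open>Relabelling the coordinates of V permutes the columns of the transposed matrix.\<close>

lemma wedge_permute:
  assumes "p permutes UNIV"
  shows "wedge (\<chi> I. M $ p I) (\<chi> I. y $ p I) (\<chi> I. z $ p I) = of_int (sign p) * wedge M y z"
proof -
  have "(\<chi> J :: 4 + 2. if J = Inr 0 then (\<chi> I. y $ p I) else if J = Inr 1 then (\<chi> I. z $ p I)
          else column (projl J) (\<chi> I. M $ p I))
      = (\<chi> J I. (\<chi> J :: 4 + 2. if J = Inr 0 then y else if J = Inr 1 then z else column (projl J) M) $ J $ p I)"
    by (auto simp: vec_eq_iff column_def)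
  then show ?thesis unfolding wedge_def by (simp only: det_permute_columns[OF assms])
qed

section \<open>Pluecker coordinates as wedges of coordinate vectors\<close>

abbreviation ex :: "4 \<Rightarrow> complex^(4 + 2)" where "ex i \<equiv> axis (Inl i) 1"
abbreviation eu :: "complex^(4 + 2)" where "eu \<equiv> axis (Inr 0) 1"
abbreviation ev :: "complex^(4 + 2)" where "ev \<equiv> axis (Inr 1) 1"

lemma UNIV_2_cases: "k = (0::2) \<or> k = 1"
  using exhaust_2[of k] by auto

lemma pl_1_eq_wedge: "pl_1 M = wedge M eu ev"
proof -
  let ?B = "\<chi> J :: 4 + 2. if J = Inr 0 then eu else if J = Inr 1 then ev else column (projl J) M"
  have "det ?B = det (\<chi> i j. ?B $ Inl i $ Inl j)"
  proof (rule det_block_identity)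
    fix k :: 2 and J :: "4 + 2"
    show "?B $ Inr k $ J = (if J = Inr k then 1 else 0)"
      using UNIV_2_cases[of k] by (auto simp: axis_def)
  qed
  also have "(\<chi> i j. ?B $ Inl i $ Inl j) = transpose (rowsel M Inl)"
    by (simp add: vec_eq_iff column_def transpose_def rowsel_def)
  finally show ?thesis by (simp add: pl_1_def wedge_def det_transpose)
qed

text \<open>A 4x4 minor of \<open>M\<close> is the x-block minor after a permutation
  \<open>p\<close> of the coordinates of V. The two omitted rows are \<open>p (Inr 0)\<close> and
  \<open>p (Inr 1)\<close>, and they become the entries of the wedge.\<close>

lemma pl_1_permute:
  assumes p: "p permutes UNIV" and u: "p (Inr 0) = a" and v: "p (Inr 1) = b"
  shows "det (rowsel M (\<lambda>i. p (Inl i))) = of_int (sign p) * wedge M (axis a 1) (axis b 1)"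
proof -
  have *: "(\<chi> I. axis (p J) 1 $ p I) = axis J (1::complex)" for J
    using permutes_inj[OF p] by (auto simp: vec_eq_iff axis_def dest: injD)
  have "det (rowsel M (\<lambda>i. p (Inl i))) = pl_1 (\<chi> I. M $ p I)"
    by (simp add: pl_1_def rowsel_def)
  also have "\<dots> = wedge (\<chi> I. M $ p I) (\<chi> I. axis a 1 $ p I) (\<chi> I. axis b 1 $ p I)"
    using *[of "Inr 0"] *[of "Inr 1"] by (simp add: pl_1_eq_wedge u v)
  finally show ?thesis using wedge_permute[OF p] by simp
qed

lemma pl_u_eq_wedge: "pl_u M k = - wedge M (ex k) ev"
proof -
  let ?p = "Transposition.transpose (Inl k) (Inr 0) :: 4 + 2 \<Rightarrow> 4 + 2"
  have "(\<lambda>i. if i = k then Inr 0 else Inl i) = (\<lambda>i. ?p (Inl i))"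
    by (auto simp: Transposition.transpose_def)
  moreover have "?p permutes UNIV" by (rule permutes_swap_id) auto
  moreover have "?p (Inr 0) = Inl k" "?p (Inr 1) = Inr 1" by (auto simp: Transposition.transpose_def)
  ultimately show ?thesis
    using pl_1_permute[of ?p "Inl k" "Inr 1" M] by (simp add: pl_u_def sign_swap_id)
qed

lemma pl_v_eq_wedge: "pl_v M k = - wedge M eu (ex k)"
proof -
  let ?p = "Transposition.transpose (Inl k) (Inr 1) :: 4 + 2 \<Rightarrow> 4 + 2"
  have "(\<lambda>i. if i = k then Inr 1 else Inl i) = (\<lambda>i. ?p (Inl i))"
    by (auto simp: Transposition.transpose_def)
  moreover have "?p permutes UNIV" by (rule permutes_swap_id) auto
  moreover have "?p (Inr 0) = Inr 0" "?p (Inr 1) = Inl k" by (auto simp: Transposition.transpose_def)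
  ultimately show ?thesis
    using pl_1_permute[of ?p "Inr 0" "Inl k" M] by (simp add: pl_v_def sign_swap_id)
qed

lemma pl_uv_eq_wedge: "pl_uv M i j = wedge M (ex i) (ex j)"
proof (cases "i = j")
  case False
  let ?s = "Transposition.transpose (Inl i) (Inr 0) :: 4 + 2 \<Rightarrow> 4 + 2"
  let ?t = "Transposition.transpose (Inl j) (Inr 1) :: 4 + 2 \<Rightarrow> 4 + 2"
  have "(\<lambda>l. if l = i then Inr 0 else if l = j then Inr 1 else Inl l) = (\<lambda>l. (?s \<circ> ?t) (Inl l))"
    using False by (auto simp: Transposition.transpose_def)
  moreover have "?s \<circ> ?t permutes UNIV" by (intro permutes_compose permutes_swap_id) auto
  moreover have "(?s \<circ> ?t) (Inr 0) = Inl i" "(?s \<circ> ?t) (Inr 1) = Inl j"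
    using False by (auto simp: Transposition.transpose_def)
  \<comment> \<open>Two transpositions: this is why \<open>pl_uv\<close> carries a plus sign, while
    \<open>pl_u\<close> and \<open>pl_v\<close>, with one transposition each, carry a minus
    sign.\<close>
  moreover have "sign (?s \<circ> ?t) = 1"
    by (simp add: sign_compose permutation_swap_id sign_swap_id)
  ultimately show ?thesis
    using pl_1_permute[of "?s \<circ> ?t" "Inl i" "Inl j" M] False by (simp add: pl_uv_def)
qed (simp add: pl_uv_def)

lemma hom_val_eq_wedge:
  "hom_val (a, b, c, m) M = (\<Sum>i\<in>UNIV. \<Sum>j\<in>UNIV. a$i$j * wedge M (ex i) (ex j))
     - (\<Sum>i\<in>UNIV. b$i * wedge M (ex i) ev) - (\<Sum>i\<in>UNIV. c$i * wedge M eu (ex i))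
     + m * wedge M eu ev"
  by (simp add: hom_val_def pl_1_eq_wedge pl_u_eq_wedge pl_v_eq_wedge pl_uv_eq_wedge sum_negf)

section \<open>Frames and the binary cubic of a pencil\<close>

text \<open>Linear independence of the list rather than of the set, so that repeated vectors are
  excluded; six such vectors form a basis of V.\<close>

definition frame :: "complex^(4 + 2) \<Rightarrow> complex^(4 + 2) \<Rightarrow> complex^(4 + 2) \<Rightarrow> complex^(4 + 2)
    \<Rightarrow> complex^(4 + 2) \<Rightarrow> complex^(4 + 2) \<Rightarrow> bool" where
  "frame a b w1 w2 w3 w4 \<longleftrightarrow> (\<forall>c1 c2 c3 c4 c5 c6.
     c1 *s a + c2 *s b + c3 *s w1 + c4 *s w2 + c5 *s w3 + c6 *s w4 = 0 \<longrightarrow>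
     c1 = 0 \<and> c2 = 0 \<and> c3 = 0 \<and> c4 = 0 \<and> c5 = 0 \<and> c6 = 0)"

lemma frameI:
  assumes "\<And>c1 c2 c3 c4 c5 c6. c1 *s a + c2 *s b + c3 *s w1 + c4 *s w2 + c5 *s w3 + c6 *s w4 = 0
    \<Longrightarrow> c1 = 0 \<and> c2 = 0 \<and> c3 = 0 \<and> c4 = 0 \<and> c5 = 0 \<and> c6 = 0"
  shows "frame a b w1 w2 w3 w4"
  using assms unfolding frame_def by blast

lemma frameD:
  assumes "frame a b w1 w2 w3 w4"
    and "c1 *s a + c2 *s b + c3 *s w1 + c4 *s w2 + c5 *s w3 + c6 *s w4 = 0"
  shows "c1 = 0" "c2 = 0" "c3 = 0" "c4 = 0" "c5 = 0" "c6 = 0"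
  using assms unfolding frame_def by blast+

text \<open>The parameters are the coefficients of the binary cubic
  \<open>q \<lambda>\<^sup>3 + s \<lambda>\<^sup>2 \<mu> + p \<lambda> \<mu>\<^sup>2 + r \<mu>\<^sup>3\<close>, which is, up to sign, the Pfaffian of the pencil of
  bivectors.\<close>

definition cubic_section :: "mat64 set \<Rightarrow> complex \<Rightarrow> complex \<Rightarrow> complex \<Rightarrow> complex \<Rightarrow> bool" where
  "cubic_section Z p q r s \<longleftrightarrow> (\<exists>a b w1 w2 w3 w4. frame a b w1 w2 w3 w4 \<and>
     (\<forall>M. M \<in> Z \<longleftrightarrow>
        wedge M a w1 + wedge M b w2 + p * wedge M w1 w2 + q * wedge M w3 w4 = 0 \<and>
        wedge M a w3 + wedge M b w4 + r * wedge M w1 w2 + s * wedge M w3 w4 = 0))"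

lemma cubic_sectionI:
  assumes "frame a b w1 w2 w3 w4"
    and "\<And>M. M \<in> Z \<longleftrightarrow>
        wedge M a w1 + wedge M b w2 + p * wedge M w1 w2 + q * wedge M w3 w4 = 0 \<and>
        wedge M a w3 + wedge M b w4 + r * wedge M w1 w2 + s * wedge M w3 w4 = 0"
  shows "cubic_section Z p q r s"
  using assms unfolding cubic_section_def by blast

lemma cubic_sectionE:
  assumes "cubic_section Z p q r s"
  obtains a b w1 w2 w3 w4 where "frame a b w1 w2 w3 w4"
    and "\<And>M. M \<in> Z \<longleftrightarrow>
        wedge M a w1 + wedge M b w2 + p * wedge M w1 w2 + q * wedge M w3 w4 = 0 \<and>
        wedge M a w3 + wedge M b w4 + r * wedge M w1 w2 + s * wedge M w3 w4 = 0"
  using assms unfolding cubic_section_def by blast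

lemma frame_shift:
  assumes "frame a b w1 w2 w3 w4"
  shows "frame (a + x1 *s w1 + x2 *s w2 + x3 *s w3 + x4 *s w4)
               (b + y1 *s w1 + y2 *s w2 + y3 *s w3 + y4 *s w4) w1 w2 w3 w4"
proof (rule frameI)
  fix c1 c2 c3 c4 c5 c6
  assume *: "c1 *s (a + x1 *s w1 + x2 *s w2 + x3 *s w3 + x4 *s w4)
    + c2 *s (b + y1 *s w1 + y2 *s w2 + y3 *s w3 + y4 *s w4)
    + c3 *s w1 + c4 *s w2 + c5 *s w3 + c6 *s w4 = 0"
  have "c1 *s a + c2 *s b + (c3 + c1 * x1 + c2 * y1) *s w1 + (c4 + c1 * x2 + c2 * y2) *s w2
     + (c5 + c1 * x3 + c2 * y3) *s w3 + (c6 + c1 * x4 + c2 * y4) *s w4 = 0"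
    unfolding *[symmetric] by (simp add: vec_eq_iff algebra_simps)
  from frameD[OF assms this]
  show "c1 = 0 \<and> c2 = 0 \<and> c3 = 0 \<and> c4 = 0 \<and> c5 = 0 \<and> c6 = 0" by simp
qed

text \<open>The eight mixed coefficients (those of neither w1 \<and> w2 nor w3 \<and> w4) are
  absorbed by the eight free coefficients in shifts of \<open>a\<close> and \<open>b\<close> along
  the \<open>w\<close>'s. The only side effects are on w1 \<and> w2 in the first equation and on w3
  \<and> w4 in the second, which explains the corrections in the parameters.\<close>

lemma cubic_section_reduce:
  assumes fr: "frame a b w1 w2 w3 w4"
    and Z: "\<And>M. M \<in> Z \<longleftrightarrow>
        wedge M a w1 + wedge M b w2 + A12 * wedge M w1 w2 + A13 * wedge M w1 w3 + A14 * wedge M w1 w4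
          + A23 * wedge M w2 w3 + A24 * wedge M w2 w4 + A34 * wedge M w3 w4 = 0 \<and>
        wedge M a w3 + wedge M b w4 + B12 * wedge M w1 w2 + B13 * wedge M w1 w3 + B14 * wedge M w1 w4
          + B23 * wedge M w2 w3 + B24 * wedge M w2 w4 + B34 * wedge M w3 w4 = 0"
  shows "cubic_section Z (A12 - B14 + B23) A34 B12 (B34 - A14 + A23)"
proof (rule cubic_sectionI[OF frame_shift[OF fr, of B13 B23 "- A13" "- A14" B14 B24 "- A23" "- A24"]])
  fix M
  note sk = wedge_skew[of M w2 w1] wedge_skew[of M w3 w1] wedge_skew[of M w4 w1]
    wedge_skew[of M w3 w2] wedge_skew[of M w4 w2] wedge_skew[of M w4 w3]
  show "M \<in> Z \<longleftrightarrow>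
    wedge M (a + B13 *s w1 + B23 *s w2 + - A13 *s w3 + - A14 *s w4) w1
      + wedge M (b + B14 *s w1 + B24 *s w2 + - A23 *s w3 + - A24 *s w4) w2
      + (A12 - B14 + B23) * wedge M w1 w2 + A34 * wedge M w3 w4 = 0 \<and>
    wedge M (a + B13 *s w1 + B23 *s w2 + - A13 *s w3 + - A14 *s w4) w3
      + wedge M (b + B14 *s w1 + B24 *s w2 + - A23 *s w3 + - A24 *s w4) w4
      + B12 * wedge M w1 w2 + (B34 - A14 + A23) * wedge M w3 w4 = 0"
    unfolding Z wedge_bilinear sk wedge_self by (simp add: algebra_simps)
qed

text \<open>Exchanging the two equations exchanges \<lambda> and \<mu> in the cubic.\<close>

lemma cubic_section_swap:
  assumes "cubic_section Z p q r s"
  shows "cubic_section Z s r q p"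
proof -
  obtain a b w1 w2 w3 w4 where fr: "frame a b w1 w2 w3 w4"
    and Z: "\<And>M. M \<in> Z \<longleftrightarrow>
        wedge M a w1 + wedge M b w2 + p * wedge M w1 w2 + q * wedge M w3 w4 = 0 \<and>
        wedge M a w3 + wedge M b w4 + r * wedge M w1 w2 + s * wedge M w3 w4 = 0"
    using assms by (rule cubic_sectionE) blast
  have "frame a b w3 w4 w1 w2"
  proof (rule frameI)
    fix c1 c2 c3 c4 c5 c6
    assume *: "c1 *s a + c2 *s b + c3 *s w3 + c4 *s w4 + c5 *s w1 + c6 *s w2 = 0"
    have "c1 *s a + c2 *s b + c5 *s w1 + c6 *s w2 + c3 *s w3 + c4 *s w4 = 0"
      using * by (simp add: ac_simps)
    from frameD[OF fr this]
    show "c1 = 0 \<and> c2 = 0 \<and> c3 = 0 \<and> c4 = 0 \<and> c5 = 0 \<and> c6 = 0" by simp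
  qed
  then show ?thesis
    by (rule cubic_sectionI) (auto simp: Z algebra_simps)
qed

text \<open>Replacing the second equation \<open>g\<close> by \<open>g + k f\<close> substitutes \<open>\<lambda> + k \<mu>\<close> for \<open>\<lambda>\<close> in the cubic.\<close>

lemma cubic_section_transvect:
  assumes "cubic_section Z p q r s"
  shows "cubic_section Z (p + 2 * k * s + 3 * k\<^sup>2 * q) q (r + k * p + k\<^sup>2 * s + k ^ 3 * q) (s + 3 * k * q)"
proof -
  obtain a b w1 w2 w3 w4 where fr: "frame a b w1 w2 w3 w4"
    and Z: "\<And>M. M \<in> Z \<longleftrightarrow>
        wedge M a w1 + wedge M b w2 + p * wedge M w1 w2 + q * wedge M w3 w4 = 0 \<and>
        wedge M a w3 + wedge M b w4 + r * wedge M w1 w2 + s * wedge M w3 w4 = 0"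
    using assms by (rule cubic_sectionE) blast
  \<comment> \<open>With these vectors the second equation plus \<open>k\<close> times the first
    again begins with a \<and> w3 + b \<and> w4.\<close>
  let ?w3 = "w3 + k *s w1" and ?w4 = "w4 + k *s w2"
  have fr': "frame a b w1 w2 ?w3 ?w4"
  proof (rule frameI)
    fix c1 c2 c3 c4 c5 c6
    assume *: "c1 *s a + c2 *s b + c3 *s w1 + c4 *s w2 + c5 *s ?w3 + c6 *s ?w4 = 0"
    have "c1 *s a + c2 *s b + (c3 + c5 * k) *s w1 + (c4 + c6 * k) *s w2 + c5 *s w3 + c6 *s w4 = 0"
      unfolding *[symmetric] by (simp add: vec_eq_iff algebra_simps)
    from frameD[OF fr this]
    show "c1 = 0 \<and> c2 = 0 \<and> c3 = 0 \<and> c4 = 0 \<and> c5 = 0 \<and> c6 = 0" by simp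
  qed
  \<comment> \<open>The coefficient of w3 \<and> w4 in the new second equation. Rewriting w3 \<and>
    w4 in the new vectors creates mixed terms, which \<open>cubic_section_reduce\<close>
    clears.\<close>
  let ?t = "s + k * q"
  have "cubic_section Z ((p + q * k\<^sup>2) - (- (k * ?t)) + k * ?t) q (r + k * p + k\<^sup>2 * ?t)
      (?t - (- (q * k)) + q * k)"
  proof (rule cubic_section_reduce[OF fr', where ?A13.0 = 0 and ?A24.0 = 0 and ?B13.0 = 0 and ?B24.0 = 0])
    fix M
    note sk = wedge_skew[of M w2 w1] wedge_skew[of M w3 w1] wedge_skew[of M w4 w1]
      wedge_skew[of M w3 w2] wedge_skew[of M w4 w2] wedge_skew[of M w4 w3]
    let ?f = "wedge M a w1 + wedge M b w2 + p * wedge M w1 w2 + q * wedge M w3 w4"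
    let ?g = "wedge M a w3 + wedge M b w4 + r * wedge M w1 w2 + s * wedge M w3 w4"
    have f: "?f = wedge M a w1 + wedge M b w2 + (p + q * k\<^sup>2) * wedge M w1 w2 + 0 * wedge M w1 ?w3
       + - (q * k) * wedge M w1 ?w4 + q * k * wedge M w2 ?w3 + 0 * wedge M w2 ?w4 + q * wedge M ?w3 ?w4"
      unfolding wedge_bilinear sk wedge_self by (simp add: algebra_simps power2_eq_square)
    have g: "?g + k * ?f = wedge M a ?w3 + wedge M b ?w4 + (r + k * p + k\<^sup>2 * ?t) * wedge M w1 w2 + 0 * wedge M w1 ?w3
       + - (k * ?t) * wedge M w1 ?w4 + k * ?t * wedge M w2 ?w3 + 0 * wedge M w2 ?w4 + ?t * wedge M ?w3 ?w4"
      unfolding wedge_bilinear sk wedge_self by (simp add: algebra_simps power2_eq_square)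
    have "M \<in> Z \<longleftrightarrow> ?f = 0 \<and> ?g + k * ?f = 0" unfolding Z by auto
    then show "M \<in> Z \<longleftrightarrow> 
       wedge M a w1 + wedge M b w2 + (p + q * k\<^sup>2) * wedge M w1 w2 + 0 * wedge M w1 ?w3
       + - (q * k) * wedge M w1 ?w4 + q * k * wedge M w2 ?w3 + 0 * wedge M w2 ?w4 + q * wedge M ?w3 ?w4 = 0 \<and>
       wedge M a ?w3 + wedge M b ?w4 + (r + k * p + k\<^sup>2 * ?t) * wedge M w1 w2 + 0 * wedge M w1 ?w3
       + - (k * ?t) * wedge M w1 ?w4 + k * ?t * wedge M w2 ?w3 + 0 * wedge M w2 ?w4 + ?t * wedge M ?w3 ?w4 = 0"
      unfolding f[symmetric] g[symmetric] .
  qed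
  then show ?thesis by (simp add: algebra_simps power2_eq_square power3_eq_cube)
qed

text \<open>Substitutes y \<lambda> for \<lambda> and x \<mu> for \<mu> in the cubic and divides it
  by \<open>x * y\<close>.\<close>

lemma cubic_section_scale:
  assumes "cubic_section Z p q r s" and x: "x \<noteq> 0" and y: "y \<noteq> 0"
  shows "cubic_section Z (p * x) (q * y\<^sup>2 / x) (r * x\<^sup>2 / y) (s * y)"
proof -
  obtain a b w1 w2 w3 w4 where fr: "frame a b w1 w2 w3 w4"
    and Z: "\<And>M. M \<in> Z \<longleftrightarrow>
        wedge M a w1 + wedge M b w2 + p * wedge M w1 w2 + q * wedge M w3 w4 = 0 \<and>
        wedge M a w3 + wedge M b w4 + r * wedge M w1 w2 + s * wedge M w3 w4 = 0"
    using assms(1) by (rule cubic_sectionE) blast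
  let ?w1 = "(1/x) *s w1" and ?w2 = "(1/x) *s w2" and ?w3 = "(1/y) *s w3" and ?w4 = "(1/y) *s w4"
  have "frame a b ?w1 ?w2 ?w3 ?w4"
  proof (rule frameI)
    fix c1 c2 c3 c4 c5 c6
    assume *: "c1 *s a + c2 *s b + c3 *s ?w1 + c4 *s ?w2 + c5 *s ?w3 + c6 *s ?w4 = 0"
    have "c1 *s a + c2 *s b + (c3 / x) *s w1 + (c4 / x) *s w2 + (c5 / y) *s w3 + (c6 / y) *s w4 = 0"
      unfolding *[symmetric] by (simp add: vec_eq_iff algebra_simps)
    from frameD[OF fr this] x y
    show "c1 = 0 \<and> c2 = 0 \<and> c3 = 0 \<and> c4 = 0 \<and> c5 = 0 \<and> c6 = 0" by simp
  qed
  then show ?thesis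
  proof (rule cubic_sectionI)
    fix M
    let ?f = "wedge M a w1 + wedge M b w2 + p * wedge M w1 w2 + q * wedge M w3 w4"
    let ?g = "wedge M a w3 + wedge M b w4 + r * wedge M w1 w2 + s * wedge M w3 w4"
    have f: "wedge M a ?w1 + wedge M b ?w2 + p * x * wedge M ?w1 ?w2 + q * y\<^sup>2 / x * wedge M ?w3 ?w4 = ?f / x"
      unfolding wedge_bilinear using x y by (simp add: field_simps power2_eq_square)
    have g: "wedge M a ?w3 + wedge M b ?w4 + r * x\<^sup>2 / y * wedge M ?w1 ?w2 + s * y * wedge M ?w3 ?w4 = ?g / y"
      unfolding wedge_bilinear using x y by (simp add: field_simps power2_eq_square)
    show "M \<in> Z \<longleftrightarrow>
      wedge M a ?w1 + wedge M b ?w2 + p * x * wedge M ?w1 ?w2 + q * y\<^sup>2 / x * wedge M ?w3 ?w4 = 0 \<and>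
      wedge M a ?w3 + wedge M b ?w4 + r * x\<^sup>2 / y * wedge M ?w1 ?w2 + s * y * wedge M ?w3 ?w4 = 0"
      unfolding f g Z using x y by simp
  qed
qed

section \<open>Orbits of binary cubics\<close>

text \<open>The expression is the coefficient of \<mu>^3 after the transvection by \<open>k\<close>,
  so a root lets that transvection remove it.\<close>

lemma cubic_root_exists:
  fixes p q r s :: complex
  assumes "q \<noteq> 0"
  shows "\<exists>k. r + k * p + k\<^sup>2 * s + k ^ 3 * q = 0"
proof -
  have "\<not> constant (poly [:r, p, s, q:])"
    using assms by (simp add: constant_degree)
  then obtain k where "poly [:r, p, s, q:] k = 0"
    using fundamental_theorem_of_algebra by blast
  then show ?thesis by (intro exI[of _ k]) (simp add: algebra_simps power2_eq_square power3_eq_cube)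
qed

text \<open>A root of the cubic is moved to \<mu> = 0, leaving \<mu> times a binary quadratic, whose
  cross term is then removed.\<close>

lemma cubic_section_normal_form:
  assumes "cubic_section Z p q r s"
  shows "cubic_section Z 0 0 0 0 \<or> cubic_section Z 0 0 1 0 \<or>
    cubic_section Z 0 0 0 1 \<or> cubic_section Z 0 0 1 1"
proof -
  \<comment> \<open>The cubic is now \<mu> (s \<lambda>^2 + r \<mu>^2). Which of \<open>r\<close>,
    \<open>s\<close> vanish decides between zero, a triple root, a double root and three distinct
    roots.\<close>
  have scale: ?thesis if *: "cubic_section Z 0 0 r s" for r s
  proof -
    \<comment> \<open>\<open>y\<close> normalises \<open>s\<close> to 1, then \<open>x\<close>
      solves r x^2 = y. A zero coefficient has nothing to normalise, hence the default 1.\<close>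
    define y where "y = (if s = 0 then 1 else 1 / s)"
    define x where "x = (if r = 0 then 1 else csqrt (y / r))"
    have y: "y \<noteq> 0" by (simp add: y_def)
    have x: "x \<noteq> 0" using y by (simp add: x_def)
    have "r * x\<^sup>2 / y = (if r = 0 then 0 else 1)" using y by (simp add: x_def)
    moreover have "s * y = (if s = 0 then 0 else 1)" by (simp add: y_def)
    ultimately show ?thesis
      using cubic_section_scale[OF * x y] by (auto split: if_splits)
  qed
  have "\<exists>p r s. cubic_section Z p 0 r s"
  proof (cases "q = 0")
    case False
    then obtain k where "r + k * p + k\<^sup>2 * s + k ^ 3 * q = 0" using cubic_root_exists by blast
    then show ?thesis
      using cubic_section_swap[OF cubic_section_transvect[OF assms, of k]] by auto
  qed (use assms in blast)
  then obtain p r s where *: "cubic_section Z p 0 r s" by blast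
  consider "s \<noteq> 0" | "s = 0" "p \<noteq> 0" | "s = 0" "p = 0" by blast
  then show ?thesis
  proof cases
    case 1
    \<comment> \<open>Completing the square in s \<lambda>^2 + p \<lambda> \<mu> + r
      \<mu>^2.\<close>
    then have "p + 2 * (- p / (2 * s)) * s = 0" by simp
    then show ?thesis
      using cubic_section_transvect[OF *, of "- p / (2 * s)"] scale by auto
  next
    case 2
    \<comment> \<open>The cubic is \<mu>^2 (p \<lambda> + r \<mu>), with a double root; moving the
      simple root to \<lambda> = 0 leaves p \<lambda> \<mu>^2, and the swap brings it to the form
      handled by \<open>scale\<close>.\<close>
    then have "r + (- r / p) * p = 0" by simp
    then have "cubic_section Z p 0 0 0"
      using cubic_section_transvect[OF *, of "- r / p"] 2 by simp
    then show ?thesis using cubic_section_swap scale by blast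
  next
    case 3
    then show ?thesis using * scale by blast
  qed
qed

section \<open>Sums and quantifiers over the coordinates of V\<close>

lemma cases_4: "i = (0::4) \<or> i = 1 \<or> i = 2 \<or> i = 3"
  using exhaust_4[of i] by auto

lemma sum_UNIV_4: "sum f (UNIV :: 4 set) = f 0 + f 1 + f 2 + f 3"
proof -
  have "(UNIV :: 4 set) = {0, 1, 2, 3}" using cases_4 by blast
  then show ?thesis unfolding \<open>UNIV = _\<close> by (simp add: add.assoc)
qed

lemma sum_UNIV_2: "sum f (UNIV :: 2 set) = f 0 + f 1"
proof -
  have "(UNIV :: 2 set) = {0, 1}" using UNIV_2_cases by blast
  then show ?thesis unfolding \<open>UNIV = _\<close> by simp
qed

lemma axis_nth_if: "axis i x $ j = (if j = i then x else 0)"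
  by (simp add: axis_def)

lemma sum_UNIV_4_plus_2:
  "sum f (UNIV :: (4 + 2) set) = f (Inl 0) + f (Inl 1) + f (Inl 2) + f (Inl 3) + f (Inr 0) + f (Inr 1)"
proof -
  have "sum f (UNIV :: (4 + 2) set) = sum (f \<circ> Inl) UNIV + sum (f \<circ> Inr) UNIV"
    unfolding UNIV_Plus_UNIV[symmetric] by (rule sum.Plus) auto
  then show ?thesis by (simp add: sum_UNIV_4 sum_UNIV_2 add.assoc)
qed

lemma forall_4_plus_2:
  "(\<forall>I :: 4 + 2. P I) \<longleftrightarrow> P (Inl 0) \<and> P (Inl 1) \<and> P (Inl 2) \<and> P (Inl 3) \<and> P (Inr 0) \<and> P (Inr 1)"
proof -
  have "(\<forall>i :: 4. P (Inl i)) \<longleftrightarrow> P (Inl 0) \<and> P (Inl 1) \<and> P (Inl 2) \<and> P (Inl 3)"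
    using cases_4 by metis
  moreover have "(\<forall>k :: 2. P (Inr k)) \<longleftrightarrow> P (Inr 0) \<and> P (Inr 1)"
    using UNIV_2_cases by metis
  ultimately show ?thesis unfolding split_sum_all by blast
qed

section \<open>Equality of cubics implies equivalence under SL(6)\<close>

definition frame_matrix :: "complex^(4 + 2) \<Rightarrow> complex^(4 + 2) \<Rightarrow> complex^(4 + 2) \<Rightarrow> complex^(4 + 2)
    \<Rightarrow> complex^(4 + 2) \<Rightarrow> complex^(4 + 2) \<Rightarrow> mat66" where
  "frame_matrix a b w1 w2 w3 w4 = (\<chi> I J. (if J = Inr 0 then a else if J = Inr 1 then b
     else if J = Inl 0 then w1 else if J = Inl 1 then w2 else if J = Inl 2 then w3 else w4) $ I)"

lemma frame_matrix_vector_mult: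
  "frame_matrix a b w1 w2 w3 w4 *v x
     = x $ Inr 0 *s a + x $ Inr 1 *s b + x $ Inl 0 *s w1 + x $ Inl 1 *s w2 + x $ Inl 2 *s w3 + x $ Inl 3 *s w4"
  by (simp add: vec_eq_iff matrix_vector_mult_def frame_matrix_def sum_UNIV_4_plus_2)

lemma invertible_frame_matrix:
  assumes "frame a b w1 w2 w3 w4"
  shows "invertible (frame_matrix a b w1 w2 w3 w4)"
  unfolding invertible_left_inverse matrix_left_invertible_ker frame_matrix_vector_mult
proof (intro allI impI)
  fix x :: "complex^(4 + 2)"
  assume "x $ Inr 0 *s a + x $ Inr 1 *s b + x $ Inl 0 *s w1 + x $ Inl 1 *s w2 + x $ Inl 2 *s w3 + x $ Inl 3 *s w4 = 0"
  from frameD[OF assms this] show "x = 0"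
    unfolding vec_eq_iff forall_4_plus_2 by simp
qed

lemma frame_transport:
  assumes fr: "frame a b w1 w2 w3 w4" and fr': "frame a' b' w1' w2' w3' w4'"
  obtains g :: mat66 where "det g \<noteq> 0" "g *v a = a'" "g *v b = b'"
    "g *v w1 = w1'" "g *v w2 = w2'" "g *v w3 = w3'" "g *v w4 = w4'"
proof -
  let ?P = "frame_matrix a b w1 w2 w3 w4" and ?P' = "frame_matrix a' b' w1' w2' w3' w4'"
  obtain Q where Q: "Q ** ?P = mat 1"
    using invertible_frame_matrix[OF fr] unfolding invertible_left_inverse by blast
  have "det Q * det ?P = 1" using arg_cong[OF Q, of det] by (simp add: det_mul)
  then have "det (?P' ** Q) \<noteq> 0"
    using invertible_frame_matrix[OF fr'] by (auto simp: det_mul invertible_det_nz)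
  moreover have g: "(?P' ** Q) *v (?P *v x) = ?P' *v x" for x
    using Q by (metis matrix_mul_assoc matrix_mul_rid matrix_vector_mul_assoc)
  ultimately show ?thesis
    using g[of "axis (Inr 0) 1"] g[of "axis (Inr 1) 1"] g[of "axis (Inl 0) 1"] g[of "axis (Inl 1) 1"]
      g[of "axis (Inl 2) 1"] g[of "axis (Inl 3) 1"]
    by (intro that[of "?P' ** Q"]) (simp_all add: frame_matrix_vector_mult axis_nth_if)
qed

lemma cubic_section_equiv:
  assumes "cubic_section Z p q r s" and "cubic_section Z' p q r s"
  shows "\<exists>g :: mat66. det g = 1 \<and> (\<forall>M. M \<in> Z \<longleftrightarrow> g ** M \<in> Z')"
proof -
  obtain a b w1 w2 w3 w4 where fr: "frame a b w1 w2 w3 w4"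
    and Z: "\<And>M. M \<in> Z \<longleftrightarrow>
        wedge M a w1 + wedge M b w2 + p * wedge M w1 w2 + q * wedge M w3 w4 = 0 \<and>
        wedge M a w3 + wedge M b w4 + r * wedge M w1 w2 + s * wedge M w3 w4 = 0"
    using assms(1) by (rule cubic_sectionE) blast
  obtain a' b' w1' w2' w3' w4' where fr': "frame a' b' w1' w2' w3' w4'"
    and Z': "\<And>M. M \<in> Z' \<longleftrightarrow>
        wedge M a' w1' + wedge M b' w2' + p * wedge M w1' w2' + q * wedge M w3' w4' = 0 \<and>
        wedge M a' w3' + wedge M b' w4' + r * wedge M w1' w2' + s * wedge M w3' w4' = 0"
    using assms(2) by (rule cubic_sectionE) blast
  obtain h :: mat66 where h: "det h \<noteq> 0" and hs: "h *v a = a'" "h *v b = b'"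
    "h *v w1 = w1'" "h *v w2 = w2'" "h *v w3 = w3'" "h *v w4 = w4'"
    using frame_transport[OF fr fr'] .
  \<comment> \<open>The matrix between the frames need not have determinant 1. Multiplying it by a
    sixth root of \<open>1 / det h\<close> corrects this, and both equations only acquire the common
    factor \<open>k\<^sup>2\<close>.\<close>
  obtain k where k: "1 / det h = k ^ 6" by (rule exists_complex_root[of 6]) auto
  with h have k0: "k \<noteq> 0" by auto
  define g where "g = mat k ** h"
  have g: "g *v x = k *s (h *v x)" for x
    by (simp add: g_def matrix_vector_mul_assoc[symmetric])
      (simp add: vec_eq_iff matrix_vector_mult_def mat_def if_distrib[of "\<lambda>x. x * _"] cong: if_cong)
  have "det (mat k :: mat66) = k ^ 6"
    by (subst det_diagonal) (simp_all add: mat_def)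
  then have det: "det g = 1" using h k[symmetric] by (simp add: g_def det_mul)
  have w: "wedge M y z = k\<^sup>2 * wedge (g ** M) (h *v y) (h *v z)" for M y z
    using wedge_mult[of g M y z] by (simp add: det g wedge_bilinear power2_eq_square mult.assoc)
  have "M \<in> Z \<longleftrightarrow> g ** M \<in> Z'" for M
  proof -
    let ?N = "g ** M"
    have f: "wedge M a w1 + wedge M b w2 + p * wedge M w1 w2 + q * wedge M w3 w4
      = k\<^sup>2 * (wedge ?N a' w1' + wedge ?N b' w2' + p * wedge ?N w1' w2' + q * wedge ?N w3' w4')"
      unfolding w[of M] hs by (simp add: algebra_simps)
    have g: "wedge M a w3 + wedge M b w4 + r * wedge M w1 w2 + s * wedge M w3 w4
      = k\<^sup>2 * (wedge ?N a' w3' + wedge ?N b' w4' + r * wedge ?N w1' w2' + s * wedge ?N w3' w4')"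
      unfolding w[of M] hs by (simp add: algebra_simps)
    show ?thesis unfolding Z Z' f g using k0 by simp
  qed
  with det show ?thesis by blast
qed

lemma full_rank_mult:
  fixes g :: mat66
  assumes "det g \<noteq> 0" and "full_rank M"
  shows "full_rank (g ** M)"
  using assms unfolding full_rank_def
  by (metis invertible_det_nz invertible_left_inverse matrix_left_invertible_ker matrix_vector_mul_assoc)

text \<open>\<open>sysX\<close> without the rank condition. Invertible matrices preserve rank, so
  the condition is restored only when passing to \<open>sl_equiv\<close>.\<close>

abbreviation pl_zeros :: "eqn \<times> eqn \<Rightarrow> mat64 set" where
  "pl_zeros S \<equiv> {M. hom_val (fst S) M = 0 \<and> hom_val (snd S) M = 0}"

lemma cubic_section_sl_equiv:
  assumes "cubic_section (pl_zeros S) p q r s" and "cubic_section (pl_zeros S') p q r s"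
  shows "sl_equiv S S'"
proof -
  obtain g :: mat66 where "det g = 1" and "\<forall>M. M \<in> pl_zeros S \<longleftrightarrow> g ** M \<in> pl_zeros S'"
    using cubic_section_equiv[OF assms] by blast
  then show ?thesis
    unfolding sl_equiv_def sysX_def by (intro exI[of _ g]) (auto intro: full_rank_mult)
qed

section \<open>The cubics of the four normal forms\<close>

lemma hom_val_u2_minus_v1: "hom_val eq_u2_minus_v1 M = - wedge M (ex 1) ev + wedge M eu (ex 0)"
  unfolding eq_u2_minus_v1_def hom_val_eq_wedge by (simp add: sum_UNIV_4 axis_nth_if)

lemmas frame_coords = vec_eq_iff forall_4_plus_2 vector_add_component vector_minus_component
  vector_uminus_component vector_smult_component zero_index axis_nth_if

text \<open>The frames for \<open>NF3\<close> and \<open>NF4\<close> come from completing the square: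
  \<open>a \<and> w3 + b \<and> w4 + w3 \<and> w4 = (w3 + b) \<and> (w4 - a) - a \<and> b\<close>.\<close>

lemma frame_NF12: "frame (- eu) (- ev) (ex 0) (ex 1) (ex 3) (- ex 2)"
  by (rule frameI) (simp only: frame_coords, simp)

lemma frame_NF3: "frame eu ev (ex 0) (ex 1) (ex 2 - ev) (ex 3 + eu)"
  by (rule frameI) (simp only: frame_coords, simp)

lemma frame_NF4: "frame (ex 0) ev (- eu) (ex 1) (ex 2 - ev) (ex 3 + ex 0)"
  by (rule frameI) (simp only: frame_coords, simp)

lemma cubic_section_NF1: "cubic_section (pl_zeros NF1) 0 0 0 0"
proof (rule cubic_sectionI[OF frame_NF12])
  fix M
  note sk = wedge_skew[of M ev "ex 1"] wedge_skew[of M ev "ex 2"]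
  have f: "wedge M (- eu) (ex 0) + wedge M (- ev) (ex 1) + 0 * wedge M (ex 0) (ex 1) + 0 * wedge M (ex 3) (- ex 2)
      = - hom_val (fst NF1) M"
    unfolding NF1_def fst_conv hom_val_u2_minus_v1 wedge_bilinear by (simp add: sk)
  have "hom_val (snd NF1) M = - wedge M (ex 2) ev - wedge M eu (ex 3)"
    unfolding NF1_def snd_conv hom_val_eq_wedge by (simp add: sum_UNIV_4 axis_nth_if)
  then have g: "wedge M (- eu) (ex 3) + wedge M (- ev) (- ex 2) + 0 * wedge M (ex 0) (ex 1) + 0 * wedge M (ex 3) (- ex 2)
      = hom_val (snd NF1) M"
    unfolding wedge_bilinear by (simp add: sk)
  show "M \<in> pl_zeros NF1 \<longleftrightarrow>
      wedge M (- eu) (ex 0) + wedge M (- ev) (ex 1) + 0 * wedge M (ex 0) (ex 1) + 0 * wedge M (ex 3) (- ex 2) = 0 \<and>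
      wedge M (- eu) (ex 3) + wedge M (- ev) (- ex 2) + 0 * wedge M (ex 0) (ex 1) + 0 * wedge M (ex 3) (- ex 2) = 0"
    unfolding f g by simp
qed

lemma cubic_section_NF2: "cubic_section (pl_zeros NF2) 0 0 1 0"
proof (rule cubic_sectionI[OF frame_NF12])
  fix M
  note sk = wedge_skew[of M ev "ex 1"] wedge_skew[of M ev "ex 2"]
  have f: "wedge M (- eu) (ex 0) + wedge M (- ev) (ex 1) + 0 * wedge M (ex 0) (ex 1) + 0 * wedge M (ex 3) (- ex 2)
      = - hom_val (fst NF2) M"
    unfolding NF2_def fst_conv hom_val_u2_minus_v1 wedge_bilinear by (simp add: sk)
  have "hom_val (snd NF2) M = wedge M (ex 0) (ex 1) - wedge M (ex 2) ev - wedge M eu (ex 3)"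
    unfolding NF2_def snd_conv hom_val_eq_wedge by (simp add: sum_UNIV_4 axis_nth_if amat_def)
  then have g: "wedge M (- eu) (ex 3) + wedge M (- ev) (- ex 2) + 1 * wedge M (ex 0) (ex 1) + 0 * wedge M (ex 3) (- ex 2)
      = hom_val (snd NF2) M"
    unfolding wedge_bilinear by (simp add: sk)
  show "M \<in> pl_zeros NF2 \<longleftrightarrow>
      wedge M (- eu) (ex 0) + wedge M (- ev) (ex 1) + 0 * wedge M (ex 0) (ex 1) + 0 * wedge M (ex 3) (- ex 2) = 0 \<and>
      wedge M (- eu) (ex 3) + wedge M (- ev) (- ex 2) + 1 * wedge M (ex 0) (ex 1) + 0 * wedge M (ex 3) (- ex 2) = 0"
    unfolding f g by simp
qed

lemma cubic_section_NF3: "cubic_section (pl_zeros NF3) 0 0 0 1"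
proof (rule cubic_sectionI[OF frame_NF3])
  fix M
  note sk = wedge_skew[of M ev "ex 1"] wedge_skew[of M ev eu] wedge_skew[of M "ex 2" eu]
  have f: "wedge M eu (ex 0) + wedge M ev (ex 1) + 0 * wedge M (ex 0) (ex 1) + 0 * wedge M (ex 2 - ev) (ex 3 + eu)
      = hom_val (fst NF3) M"
    unfolding NF3_def fst_conv hom_val_u2_minus_v1 wedge_bilinear by (simp add: sk)
  have "hom_val (snd NF3) M = wedge M (ex 2) (ex 3) - wedge M eu ev"
    unfolding NF3_def snd_conv hom_val_eq_wedge by (simp add: sum_UNIV_4 axis_nth_if amat_def)
  then have g: "wedge M eu (ex 2 - ev) + wedge M ev (ex 3 + eu) + 0 * wedge M (ex 0) (ex 1) + 1 * wedge M (ex 2 - ev) (ex 3 + eu)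
      = hom_val (snd NF3) M"
    unfolding wedge_bilinear by (simp add: sk)
  show "M \<in> pl_zeros NF3 \<longleftrightarrow>
      wedge M eu (ex 0) + wedge M ev (ex 1) + 0 * wedge M (ex 0) (ex 1) + 0 * wedge M (ex 2 - ev) (ex 3 + eu) = 0 \<and>
      wedge M eu (ex 2 - ev) + wedge M ev (ex 3 + eu) + 0 * wedge M (ex 0) (ex 1) + 1 * wedge M (ex 2 - ev) (ex 3 + eu) = 0"
    unfolding f g by simp
qed

text \<open>Compared with \<open>NF3\<close>, \<open>a\<close> and \<open>w1\<close> trade places up
  to sign. The term - a \<and> b left by completing the square then supplies \<open>u_1\<close>, and
  w1 \<and> w2 supplies \<open>v_2\<close>.\<close>

lemma cubic_section_NF4: "cubic_section (pl_zeros NF4) 0 0 1 1"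
proof (rule cubic_sectionI[OF frame_NF4])
  fix M
  note sk = wedge_skew[of M ev "ex 1"] wedge_skew[of M ev "ex 0"]
    wedge_skew[of M "ex 2" "ex 0"] wedge_skew[of M "ex 0" eu]
  have f: "wedge M (ex 0) (- eu) + wedge M ev (ex 1) + 0 * wedge M (- eu) (ex 1) + 0 * wedge M (ex 2 - ev) (ex 3 + ex 0)
      = hom_val (fst NF4) M"
    unfolding NF4_def fst_conv hom_val_u2_minus_v1 wedge_bilinear by (simp add: sk)
  have "hom_val (snd NF4) M = wedge M (ex 2) (ex 3) - wedge M (ex 0) ev - wedge M eu (ex 1)"
    unfolding NF4_def snd_conv hom_val_eq_wedge by (simp add: sum_UNIV_4 axis_nth_if amat_def)
  then have g: "wedge M (ex 0) (ex 2 - ev) + wedge M ev (ex 3 + ex 0) + 1 * wedge M (- eu) (ex 1) + 1 * wedge M (ex 2 - ev) (ex 3 + ex 0)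
      = hom_val (snd NF4) M"
    unfolding wedge_bilinear by (simp add: sk)
  show "M \<in> pl_zeros NF4 \<longleftrightarrow>
      wedge M (ex 0) (- eu) + wedge M ev (ex 1) + 0 * wedge M (- eu) (ex 1) + 0 * wedge M (ex 2 - ev) (ex 3 + ex 0) = 0 \<and>
      wedge M (ex 0) (ex 2 - ev) + wedge M ev (ex 3 + ex 0) + 1 * wedge M (- eu) (ex 1) + 1 * wedge M (ex 2 - ev) (ex 3 + ex 0) = 0"
    unfolding f g by simp
qed

section \<open>Expansion of the pencil at a solution point\<close>

lemma eq_du_formula: "eq_du (a, b, c, m) u v i = b$i + (\<Sum>j\<in>UNIV. (a$i$j - a$j$i) * v$j)"
proof -
  have "(\<lambda>t. eq_val (a, b, c, m) (u + t *s axis i 1) v)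
      = (\<lambda>t. eq_val (a, b, c, m) u v + t * (b$i + (\<Sum>j\<in>UNIV. (a$i$j - a$j$i) * v$j)))"
    using cases_4[of i] by (auto simp: eq_val_def sum_UNIV_4 axis_nth_if fun_eq_iff algebra_simps)
  then show ?thesis
    unfolding eq_du_def by (simp, intro DERIV_imp_deriv) (auto intro!: derivative_eq_intros)
qed

lemma eq_dv_formula: "eq_dv (a, b, c, m) u v i = c$i + (\<Sum>j\<in>UNIV. (a$j$i - a$i$j) * u$j)"
proof -
  have "(\<lambda>t. eq_val (a, b, c, m) u (v + t *s axis i 1))
      = (\<lambda>t. eq_val (a, b, c, m) u v + t * (c$i + (\<Sum>j\<in>UNIV. (a$j$i - a$i$j) * u$j)))"
    using cases_4[of i] by (auto simp: eq_val_def sum_UNIV_4 axis_nth_if fun_eq_iff algebra_simps)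
  then show ?thesis
    unfolding eq_dv_def by (simp, intro DERIV_imp_deriv) (auto intro!: derivative_eq_intros)
qed

text \<open>These vectors span the 4-plane with slopes \<open>u\<close>, \<open>v\<close>; with
  \<open>eu\<close> and \<open>ev\<close> they form a basis of V.\<close>

abbreviation tangent :: "complex^4 \<Rightarrow> complex^4 \<Rightarrow> 4 \<Rightarrow> complex^(4 + 2)" where
  "tangent u v i \<equiv> ex i + u$i *s eu + v$i *s ev"

text \<open>A Taylor expansion at the point: replacing each \<open>ex i\<close> by its tangent
  vector minus multiples of \<open>eu\<close> and \<open>ev\<close> leaves the value as constant
  term, the derivatives as linear terms and the same quadratic coefficients.\<close>

lemma hom_val_at_point:
  "hom_val (a, b, c, m) M = eq_val (a, b, c, m) u v * wedge M eu ev
     - wedge M (\<Sum>i\<in>UNIV. eq_du (a, b, c, m) u v i *s tangent u v i) ev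
     - wedge M eu (\<Sum>i\<in>UNIV. eq_dv (a, b, c, m) u v i *s tangent u v i)
     + (\<Sum>i\<in>UNIV. \<Sum>j\<in>UNIV. a$i$j * wedge M (tangent u v i) (tangent u v j))"
proof -
  have sk: "wedge M ev eu = - wedge M eu ev" "\<And>i. wedge M ev (ex i) = - wedge M (ex i) ev"
    "\<And>i. wedge M (ex i) eu = - wedge M eu (ex i)"
    by (rule wedge_skew)+
  show ?thesis
    unfolding hom_val_eq_wedge eq_val_def prod.case eq_du_formula eq_dv_formula sum_UNIV_4
      wedge_bilinear sk wedge_self
    by (simp add: algebra_simps)
qed

lemma char_form_eq:
  "char_form F G u v p =
     (\<Sum>i\<in>UNIV. eq_du F u v i * p$i) * (\<Sum>i\<in>UNIV. eq_dv G u v i * p$i)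
   - (\<Sum>i\<in>UNIV. eq_dv F u v i * p$i) * (\<Sum>i\<in>UNIV. eq_du G u v i * p$i)"
  unfolding char_form_def det_2 by (simp add: algebra_simps)

text \<open>Order and signs make the rows the coordinates, in the tangent vectors, of w1, ..., w4 in
  eu \<and> w1 + ev \<and> w2 and eu \<and> w3 + ev \<and> w4.\<close>

definition symbol_matrix :: "eqn \<Rightarrow> eqn \<Rightarrow> complex^4 \<Rightarrow> complex^4 \<Rightarrow> complex^4^4" where
  "symbol_matrix F G u v = (\<chi> k i. if k = 0 then - eq_dv F u v i else if k = 1 then eq_du F u v i
     else if k = 2 then - eq_dv G u v i else eq_du G u v i)"

lemma invertible_symbol_matrix:
  assumes "quadric_rank4 (char_form F G u v)"
  shows "invertible (symbol_matrix F G u v)"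
proof -
  obtain S :: "complex^4^4" where S: "transpose S = S"
    "\<And>p. char_form F G u v p = (\<Sum>i\<in>UNIV. p$i * (S *v p)$i)" "det S \<noteq> 0"
    using assms unfolding quadric_rank4_def by blast
  \<comment> \<open>The form is built from the four rows of the symbol matrix, so a common zero of the rows
    is a singular point of the quadric.\<close>
  have "p = 0" if p: "symbol_matrix F G u v *v p = 0" for p
  proof -
    have z: "(\<Sum>i\<in>UNIV. eq_du F u v i * p$i) = 0" "(\<Sum>i\<in>UNIV. eq_dv F u v i * p$i) = 0"
      "(\<Sum>i\<in>UNIV. eq_du G u v i * p$i) = 0" "(\<Sum>i\<in>UNIV. eq_dv G u v i * p$i) = 0"
      using arg_cong[OF p, of "\<lambda>x. x $ 0"] arg_cong[OF p, of "\<lambda>x. x $ 1"]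
        arg_cong[OF p, of "\<lambda>x. x $ 2"] arg_cong[OF p, of "\<lambda>x. x $ 3"]
      by (simp_all add: matrix_vector_mult_def symbol_matrix_def sum_negf)
    have sym: "S $ i $ j = S $ j $ i" for i j
      using arg_cong[OF S(1), of "\<lambda>A. A $ i $ j"] by (simp add: transpose_def)
    have "(S *v p) $ k = 0" for k
    proof -
      \<comment> \<open>Polarisation: the mixed term of the form at \<open>p\<close> vanishes
        because all four linear factors vanish there.\<close>
      have "char_form F G u v (p + axis k 1) - char_form F G u v (axis k 1) - char_form F G u v p = 0"
        unfolding char_form_eq by (simp add: z distrib_left sum.distrib)
      moreover have "char_form F G u v (p + axis k 1) - char_form F G u v (axis k 1) - char_form F G u v p
          = 2 * (S *v p) $ k"
        unfolding S(2) using cases_4[of k] sym[of 1 2] sym[of 1 3] sym[of 1 0]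
          sym[of 2 3] sym[of 2 0] sym[of 3 0]
        by (auto simp: matrix_vector_mult_def sum_UNIV_4 axis_nth_if algebra_simps)
      ultimately show ?thesis by simp
    qed
    then have "S *v p = 0" by (simp add: vec_eq_iff)
    then show "p = 0"
      using S(3) by (metis invertible_det_nz invertible_left_inverse matrix_left_invertible_ker)
  qed
  then show ?thesis unfolding invertible_left_inverse matrix_left_invertible_ker by blast
qed

lemma wedge_span4:
  assumes "y = y1 *s w1 + y2 *s w2 + y3 *s w3 + y4 *s w4" "z = z1 *s w1 + z2 *s w2 + z3 *s w3 + z4 *s w4"
  shows "wedge M y z = (y1 * z2 - y2 * z1) * wedge M w1 w2 + (y1 * z3 - y3 * z1) * wedge M w1 w3
    + (y1 * z4 - y4 * z1) * wedge M w1 w4 + (y2 * z3 - y3 * z2) * wedge M w2 w3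
    + (y2 * z4 - y4 * z2) * wedge M w2 w4 + (y3 * z4 - y4 * z3) * wedge M w3 w4"
  unfolding assms wedge_bilinear wedge_self wedge_skew[of M w2 w1] wedge_skew[of M w3 w1]
    wedge_skew[of M w4 w1] wedge_skew[of M w3 w2] wedge_skew[of M w4 w2] wedge_skew[of M w4 w3]
  by (simp add: algebra_simps)

lemma wedge_quadratic_span4:
  fixes a :: "complex^4^4" and t :: "4 \<Rightarrow> complex^(4 + 2)"
  assumes t: "\<And>i. t i = x i 0 *s w1 + x i 1 *s w2 + x i 2 *s w3 + x i (3::4) *s w4"
  shows "\<exists>A12 A13 A14 A23 A24 A34. \<forall>M. (\<Sum>i\<in>UNIV. \<Sum>j\<in>UNIV. a$i$j * wedge M (t i) (t j))
    = A12 * wedge M w1 w2 + A13 * wedge M w1 w3 + A14 * wedge M w1 w4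
      + A23 * wedge M w2 w3 + A24 * wedge M w2 w4 + A34 * wedge M w3 w4"
proof (intro exI allI)
  \<comment> \<open>The 2x2 minors of the coordinates, contracted with \<open>a\<close>; they do not
    depend on \<open>M\<close>.\<close>
  let ?A = "\<lambda>k l. \<Sum>i\<in>UNIV. \<Sum>j\<in>UNIV. a$i$j * (x i k * x j l - x i l * x j k)"
  fix M
  show "(\<Sum>i\<in>UNIV. \<Sum>j\<in>UNIV. a$i$j * wedge M (t i) (t j))
    = ?A 0 1 * wedge M w1 w2 + ?A 0 2 * wedge M w1 w3 + ?A 0 3 * wedge M w1 w4
      + ?A 1 2 * wedge M w2 w3 + ?A 1 3 * wedge M w2 w4 + ?A 2 3 * wedge M w3 w4"
    unfolding wedge_span4[OF t t]
    by (simp only: sum_distrib_right distrib_left sum.distrib mult.assoc)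
qed

lemma nondegenerate_cubic_section:
  assumes "nondegenerate F G"
  shows "\<exists>p q r s. cubic_section (pl_zeros (F, G)) p q r s"
proof -
  obtain u v where F0: "eq_val F u v = 0" and G0: "eq_val G u v = 0"
    and rk: "quadric_rank4 (char_form F G u v)"
  proof -
    let ?R = "{(u, v) \<in> sol_pts F G. irreducible_quadric (char_form F G u v) \<and> quadric_rank4 (char_form F G u v)}"
    \<comment> \<open>The closure of \<open>?R\<close> contains a nonempty set, so a solution point
      of rank 4 exists.\<close>
    have "?R \<noteq> {}" using assms unfolding nondegenerate_def by (metis closure_empty subset_empty)
    then show thesis using that unfolding sol_pts_def by auto
  qed
  let ?D = "symbol_matrix F G u v"
  let ?t = "tangent u v"
  define w where "w k = (\<Sum>i\<in>UNIV. ?D $ k $ i *s ?t i)" for k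
  obtain X where X: "X ** ?D = mat 1" "?D ** X = mat 1"
    using invertible_symbol_matrix[OF rk] unfolding invertible_def by blast
  \<comment> \<open>Inverting the symbol matrix expresses the tangent vectors in the
    \<open>w\<close>'s, so the quadratic parts become bivectors in the \<open>w\<close>'s.\<close>
  have t: "?t i = X$i$0 *s w 0 + X$i$1 *s w 1 + X$i$2 *s w 2 + X$i$3 *s w 3" for i
  proof -
    have "X$i$0 *s w 0 + X$i$1 *s w 1 + X$i$2 *s w 2 + X$i$3 *s w 3 = (\<Sum>k\<in>UNIV. X$i$k *s w k)"
      by (simp add: sum_UNIV_4 ac_simps)
    also have "\<dots> = (\<Sum>k\<in>UNIV. \<Sum>j\<in>UNIV. (X$i$k * ?D$k$j) *s ?t j)"
      by (simp add: w_def vec.scale_sum_right mult.assoc)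
    also have "\<dots> = (\<Sum>j\<in>UNIV. (X ** ?D)$i$j *s ?t j)"
      by (subst sum.swap) (simp only: matrix_matrix_mult_def vec_lambda_beta vec.scale_sum_left)
    also have "\<dots> = ?t i"
      using cases_4[of i] by (auto simp: X mat_def sum_UNIV_4)
    finally show ?thesis by simp
  qed
  have fr: "frame eu ev (w 0) (w 1) (w 2) (w 3)"
  proof (rule frameI)
    fix c1 c2 c3 c4 c5 c6
    assume *: "c1 *s eu + c2 *s ev + c3 *s w 0 + c4 *s w 1 + c5 *s w 2 + c6 *s w 3 = 0"
    define c :: "complex^4" where "c = (\<chi> k. if k = 0 then c3 else if k = 1 then c4 else if k = 2 then c5 else c6)"
    \<comment> \<open>The x-components ignore \<open>eu\<close> and \<open>ev\<close> and turn a
      relation among the \<open>w\<close>'s into one among the rows of the symbol matrix.\<close>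
    have wl: "w k $ Inl j = ?D $ k $ j" for k j
      using cases_4[of j] by (auto simp: w_def sum_UNIV_4 axis_nth_if)
    have "(c v* ?D) $ j = 0" for j
      using arg_cong[OF *, of "\<lambda>x. x $ Inl j"]
      by (simp add: wl vector_matrix_mult_def sum_UNIV_4 c_def axis_nth_if algebra_simps)
    then have "c v* ?D = 0" by (simp add: vec_eq_iff)
    then have "(c v* ?D) v* X = 0" by simp
    then have c0: "c = 0" by (simp add: vector_matrix_mul_assoc X)
    have c: "c3 = 0" "c4 = 0" "c5 = 0" "c6 = 0"
      using arg_cong[OF c0, of "\<lambda>x. x $ 0"] arg_cong[OF c0, of "\<lambda>x. x $ 1"]
        arg_cong[OF c0, of "\<lambda>x. x $ 2"] arg_cong[OF c0, of "\<lambda>x. x $ 3"]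
      by (simp_all add: c_def)
    with * have "c1 *s eu + c2 *s ev = 0" by simp
    then have "c1 = 0" "c2 = 0" by (simp_all add: vec_eq_iff forall_4_plus_2 axis_nth_if)
    with c show "c1 = 0 \<and> c2 = 0 \<and> c3 = 0 \<and> c4 = 0 \<and> c5 = 0 \<and> c6 = 0" by simp
  qed
  obtain a b c m where F: "F = (a, b, c, m)" by (cases F)
  obtain a' b' c' m' where G: "G = (a', b', c', m')" by (cases G)
  obtain A12 A13 A14 A23 A24 A34 where A: "\<And>M. (\<Sum>i\<in>UNIV. \<Sum>j\<in>UNIV. a$i$j * wedge M (?t i) (?t j))
    = A12 * wedge M (w 0) (w 1) + A13 * wedge M (w 0) (w 2) + A14 * wedge M (w 0) (w 3)
      + A23 * wedge M (w 1) (w 2) + A24 * wedge M (w 1) (w 3) + A34 * wedge M (w 2) (w 3)"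
    using wedge_quadratic_span4[of ?t "\<lambda>i k. X$i$k", OF t, of a] by blast
  obtain B12 B13 B14 B23 B24 B34 where B: "\<And>M. (\<Sum>i\<in>UNIV. \<Sum>j\<in>UNIV. a'$i$j * wedge M (?t i) (?t j))
    = B12 * wedge M (w 0) (w 1) + B13 * wedge M (w 0) (w 2) + B14 * wedge M (w 0) (w 3)
      + B23 * wedge M (w 1) (w 2) + B24 * wedge M (w 1) (w 3) + B34 * wedge M (w 2) (w 3)"
    using wedge_quadratic_span4[of ?t "\<lambda>i k. X$i$k", OF t, of a'] by blast
  have w: "(\<Sum>i\<in>UNIV. eq_dv F u v i *s ?t i) = - w 0" "(\<Sum>i\<in>UNIV. eq_du F u v i *s ?t i) = w 1"
    "(\<Sum>i\<in>UNIV. eq_dv G u v i *s ?t i) = - w 2" "(\<Sum>i\<in>UNIV. eq_du G u v i *s ?t i) = w 3"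
    by (simp_all add: w_def symbol_matrix_def sum_negf[symmetric] algebra_simps)
  \<comment> \<open>The eu \<and> ev term of the expansion drops out because the point solves the
    equation.\<close>
  have hF: "hom_val F M = wedge M eu (w 0) + wedge M ev (w 1)
      + A12 * wedge M (w 0) (w 1) + A13 * wedge M (w 0) (w 2) + A14 * wedge M (w 0) (w 3)
      + A23 * wedge M (w 1) (w 2) + A24 * wedge M (w 1) (w 3) + A34 * wedge M (w 2) (w 3)" for M
    using hom_val_at_point[of a b c m M u v] wedge_skew[of M "w 1" ev]
    unfolding A F[symmetric] w F0 wedge_minus by simp
  have hG: "hom_val G M = wedge M eu (w 2) + wedge M ev (w 3)
      + B12 * wedge M (w 0) (w 1) + B13 * wedge M (w 0) (w 2) + B14 * wedge M (w 0) (w 3)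
      + B23 * wedge M (w 1) (w 2) + B24 * wedge M (w 1) (w 3) + B34 * wedge M (w 2) (w 3)" for M
    using hom_val_at_point[of a' b' c' m' M u v] wedge_skew[of M "w 3" ev]
    unfolding B G[symmetric] w G0 wedge_minus by simp
  have "cubic_section (pl_zeros (F, G)) (A12 - B14 + B23) A34 B12 (B34 - A14 + A23)"
    by (rule cubic_section_reduce[OF fr]) (simp only: mem_Collect_eq fst_conv snd_conv hF hG)
  then show ?thesis by blast
qed

theorem theorem2:
  fixes F G :: eqn
  assumes "nondegenerate F G"
  shows "sl_equiv (F, G) NF1 \<or> sl_equiv (F, G) NF2 \<or> sl_equiv (F, G) NF3 \<or> sl_equiv (F, G) NF4"
proof -
  obtain p q r s where "cubic_section (pl_zeros (F, G)) p q r s"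
    using nondegenerate_cubic_section[OF assms] by blast
  from cubic_section_normal_form[OF this] show ?thesis
    using cubic_section_sl_equiv cubic_section_NF1 cubic_section_NF2 cubic_section_NF3 cubic_section_NF4
    by blast
qed

end
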